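(* Let $\ell,r\ge1$ be integers, $N=\ell+r$, $\Delta=\gcd(\ell,r)$, and for a positive integer $m$ let $\Delta_m=\gcd(\Delta,m)$. Consider the canonical negative-negative double Boolean automata circuit $D_{\ell,r}$ (both side-circuits negative, of sizes $\ell$ and $r$). Let $p\in\mathbb{N}$ divide $N$ but divide neither $\ell$ nor $r$. Then the number $C_p(\ell,r)$ of configurations of period $p$ of $D_{\ell,r}$ depends only on $p$ and $\Delta_p$; it is given by $$C_p(\ell,r)=C_{p,\Delta_p}=P\!\left(\frac p{\Delta_p}\right)^{\Delta_p}.$$ The number of attractors of period $p$ and the total number of attractors of $D_{\ell,r}$ are respectively given by $$\mathtt{A}^{=}_p(\ell,r)=\frac1p\sum_{q\mid p}\mu\!\left(\frac pq\right)P\!\left(\frac q{\Delta_q}\right)^{\Delta_q},\qquad \mathtt{T}^{=}(\ell,r)=\frac1N\sum_{m\mid N}\psi\!\left(\frac Nm\right)P\!\left(\frac m{\Delta_m}\right)^{\Delta_m}$$ (the formula for $\mathtt{T}^{=}(\ell,r)$ involves no choice of $p$, and shows that $\mathtt{T}^{=}(\ell,r)$ depends only on $N$ and $\Delta$).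
   Context: The canonical negative-negative double Boolean automata circuit $D_{\ell,r}$ has $n=\ell+r-1$ nodes $0,\ldots,n-1$. For a configuration $x=(x_0,\ldots,x_{n-1})\in\{0,1\}^n$ write $x^L=(x_0,\ldots,x_{\ell-1})$ (states of the left-circuit) and $x^R=(x_0,x_\ell,\ldots,x_{n-1})$ (states of the right-circuit, $r$ entries; $x^R=(x_0)$ if $r=1$). All nodes are updated in parallel by $F:\{0,1\}^n\to\{0,1\}^n$: $F(x)_i=x_{i-1}$ for $i\notin\{0,\ell\}$; $F(x)_\ell=x_0$ (if $r\ge2$); and $F(x)_0=\neg a\vee\neg b$, where $a=x_{\ell-1}$ is the last entry of $x^L$ and $b$ is the last entry of $x^R$ (so $b=x_{n-1}$ when $r\ge 2$, and $b=x_0$ when $r=1$). A configuration $x$ has period $p$ if $F^{p}(x)=x$ ($p$ need not be minimal); it has exact period $p$ if moreover it has no period $d<p$, $d\ge1$. An attractor of period $p$ is the orbit under $F$ of a configuration of exact period $p$ (fixed points are the attractors of period $1$); the total number of attractors counts attractors of all periods. $\mu$ is the Möbius function and $\psi$ is Euler's totient function. $P$ is the Perrin sequence: $P(0)=3$, $P(1)=0$, $P(2)=2$, $P(m)=P(m-2)+P(m-3)$ for $m\ge3$. *)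

theory Defs
  imports
    Complex_Main
    "HOL-Computational_Algebra.Squarefree"
    "HOL-Number_Theory.Totient"
    "HOL-Combinatorics.Orbits"
begin

definition configs :: "nat \<Rightarrow> nat \<Rightarrow> bool list set" where
  "configs l r = {x. length x = l + r - 1}"

definition left_part :: "nat \<Rightarrow> bool list \<Rightarrow> bool list" where
  "left_part l x = take l x"

(* The intersection node 0 belongs to both side-circuits; for r = 1 this is [x ! 0]. *)
definition right_part :: "nat \<Rightarrow> bool list \<Rightarrow> bool list" where
  "right_part l x = x ! 0 # drop l x"

(* For r = 1 the indices below l + r - 1 do not reach l, so the second case never applies. *)
definition dbac_step :: "nat \<Rightarrow> nat \<Rightarrow> bool list \<Rightarrow> bool list" where
  "dbac_step l r x =
     map (\<lambda>i. if i = 0 then \<not> last (left_part l x) \<or> \<not> last (right_part l x)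
              else if i = l then x ! 0
              else x ! (i - 1)) [0..<l + r - 1]"

definition has_period :: "nat \<Rightarrow> nat \<Rightarrow> nat \<Rightarrow> bool list \<Rightarrow> bool" where
  "has_period l r p x \<longleftrightarrow> p \<ge> 1 \<and> (dbac_step l r ^^ p) x = x"

definition has_exact_period :: "nat \<Rightarrow> nat \<Rightarrow> nat \<Rightarrow> bool list \<Rightarrow> bool" where
  "has_exact_period l r p x \<longleftrightarrow> has_period l r p x \<and> (\<forall>d<p. \<not> has_period l r d x)"

definition num_period_configs :: "nat \<Rightarrow> nat \<Rightarrow> nat \<Rightarrow> nat" where
  "num_period_configs p l r = card {x \<in> configs l r. has_period l r p x}"

(* The library's orbit starts at the image of x; it contains x itself because x is periodic. *)
definition attractors_of_period :: "nat \<Rightarrow> nat \<Rightarrow> nat \<Rightarrow> bool list set set" where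
  "attractors_of_period p l r =
     orbit (dbac_step l r) ` {x \<in> configs l r. has_exact_period l r p x}"

definition num_attractors_of_period :: "nat \<Rightarrow> nat \<Rightarrow> nat \<Rightarrow> nat" where
  "num_attractors_of_period p l r = card (attractors_of_period p l r)"

definition num_attractors :: "nat \<Rightarrow> nat \<Rightarrow> nat" where
  "num_attractors l r = card (\<Union>p\<in>{1..}. attractors_of_period p l r)"

fun perrin :: "nat \<Rightarrow> nat" where
  "perrin 0 = 3"
| "perrin (Suc 0) = 0"
| "perrin (Suc (Suc 0)) = 2"
| "perrin (Suc (Suc (Suc m))) = perrin (Suc m) + perrin m"

definition moebius_mu :: "nat \<Rightarrow> int" where
  "moebius_mu n = (if squarefree n then (- 1) ^ card (prime_factors n) else 0)"

end

theory Submission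
  imports Defs "HOL-Library.FuncSet"
begin

text \<open>A configuration of period \<open>p\<close> is encoded by the \<open>p\<close>-periodic sequence \<open>y\<close> of values of the
  intersection node, which satisfies \<open>y t = (\<not> (y (t - l) \<and> y (t - r)))\<close>. If \<open>p\<close> divides \<open>l + r\<close>,
  the shifts \<open>l\<close> and \<open>r\<close> are opposite modulo \<open>p\<close>, so \<open>y\<close> splits into \<open>gcd r p\<close> independent circular
  words of length \<open>p div gcd r p\<close> in which every letter is the NAND of its two neighbours; a
  transfer matrix counts these by the Perrin numbers. Every period divides \<open>l + r\<close>, because zeros
  of \<open>y\<close> propagate by \<open>l + r\<close>. Inverting the sum over divisors then counts the attractors.\<close>

section \<open>Sums over divisors\<close>

lemma moebius_mu_prime_mult:
  assumes "prime q" "\<not> q dvd d" "squarefree d"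
  shows "moebius_mu (q * d) = - moebius_mu d"
proof -
  have "d \<noteq> 0"
    using assms(3) by (metis not_squarefree_0)
  have "coprime q d"
    using assms by (simp add: prime_imp_coprime)
  then have "squarefree (q * d)"
    using assms squarefree_mult_coprime squarefree_prime by blast
  moreover have "prime_factors (q * d) = insert q (prime_factors d)"
    using assms \<open>d \<noteq> 0\<close> by (subst prime_factorization_mult) (auto simp: prime_factorization_prime)
  moreover have "q \<notin> prime_factors d"
    using assms by auto
  ultimately show ?thesis
    using assms by (simp add: moebius_mu_def)
qed

text \<open>Fix a prime \<open>q\<close> dividing \<open>n\<close>. The squarefree divisors in
  \<open>D\<close> avoid \<open>q\<close>, and the others are exactly \<open>q * d\<close> with
  \<open>d\<close> in \<open>D\<close>; multiplying by \<open>q\<close> flips the sign, so the terms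
  cancel in pairs.\<close>

lemma sum_moebius_mu:
  assumes "n > 0"
  shows "(\<Sum>d | d dvd n. moebius_mu d) = (if n = 1 then 1 else 0)"
proof (cases "n = 1")
  case True
  then show ?thesis
    by (simp add: moebius_mu_def)
next
  case False
  then obtain q where q: "prime q" "q dvd n"
    using prime_factor_nat by blast
  define D where "D = {d. d dvd n \<and> squarefree d \<and> \<not> q dvd d}"
  have finD: "finite D"
    using assms by (simp add: D_def)
  have div: "{d. d dvd n \<and> squarefree d} = D \<union> (*) q ` D"
  proof (intro equalityI subsetI)
    fix d assume "d \<in> {d. d dvd n \<and> squarefree d}"
    then have d: "d dvd n" "squarefree d"
      by auto
    show "d \<in> D \<union> (*) q ` D"
    proof (cases "q dvd d")
      case True
      then obtain e where e: "d = q * e"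
        by (elim dvdE)
      have "\<not> q dvd e"
      proof
        assume "q dvd e"
        then have "q ^ 2 dvd d"
          by (simp add: e power2_eq_square)
        then have "q dvd 1"
          using d(2) squarefreeD by blast
        then show False
          using q(1) by auto
      qed
      then have "e \<in> D"
        using d e squarefree_multD(2)[of q e] by (auto simp: D_def intro: dvd_mult_right)
      then show ?thesis
        using e by blast
    qed (use d in \<open>simp add: D_def\<close>)
  next
    fix d assume "d \<in> D \<union> (*) q ` D"
    moreover have "q * e dvd n" "squarefree (q * e)" if "e \<in> D" for e
    proof -
      have "coprime q e"
        using that q(1) by (simp add: D_def prime_imp_coprime)
      then show "q * e dvd n" "squarefree (q * e)"
        using that q squarefree_mult_coprime squarefree_prime
        by (auto simp: D_def intro: divides_mult)
    qed
    ultimately show "d \<in> {d. d dvd n \<and> squarefree d}"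
      by (auto simp: D_def)
  qed
  have "(\<Sum>d | d dvd n. moebius_mu d) = (\<Sum>d | d dvd n \<and> squarefree d. moebius_mu d)"
    using assms by (intro sum.mono_neutral_right) (auto simp: moebius_mu_def)
  also have "\<dots> = sum moebius_mu D + sum moebius_mu ((*) q ` D)"
    unfolding div using finD by (intro sum.union_disjoint finite_imageI) (auto simp: D_def)
  also have "sum moebius_mu ((*) q ` D) = (\<Sum>d\<in>D. moebius_mu (q * d))"
    using q by (subst sum.reindex) (auto simp: inj_on_def)
  also have "\<dots> = - sum moebius_mu D"
    using q by (subst sum_negf[symmetric], intro sum.cong refl moebius_mu_prime_mult) (auto simp: D_def)
  finally show ?thesis
    using False by simp
qed

text \<open>Both sides run over chains d | q | n, and \<open>k = n div q\<close> turns such a chain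
  into a divisor \<open>k\<close> of \<open>n div d\<close>. With \<open>g\<close> the Moebius
  function or the totient, the inner sum on the right has a closed form.\<close>

lemma sum_divisors_convolution:
  fixes g e :: "nat \<Rightarrow> 'a :: comm_semiring_1"
  assumes "n > 0"
  shows "(\<Sum>q | q dvd n. g (n div q) * (\<Sum>d | d dvd q. e d))
    = (\<Sum>d | d dvd n. e d * (\<Sum>k | k dvd n div d. g k))"
proof -
  have fin: "finite {d. d dvd q}" if "q dvd n" for q
    using assms that by (simp add: dvd_pos_nat)
  have fin': "finite {k. k dvd n div d}" if "d dvd n" for d
    using assms that by (auto simp: dvd_div_eq_0_iff)
  have "(\<Sum>q | q dvd n. g (n div q) * (\<Sum>d | d dvd q. e d))
      = (\<Sum>(q, d)\<in>(SIGMA q:{q. q dvd n}. {d. d dvd q}). g (n div q) * e d)"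
    unfolding sum_distrib_left using assms fin by (subst sum.Sigma) auto
  also have "\<dots> = (\<Sum>(d, k)\<in>(SIGMA d:{d. d dvd n}. {k. k dvd n div d}). e d * g k)"
    by (rule sum.reindex_bij_witness[where i = "\<lambda>(d, k). (n div k, d)" and j = "\<lambda>(q, d). (d, n div q)"])
      (use assms in \<open>auto simp: mult.commute div_dvd_div elim!: dvdE\<close>)
  also have "\<dots> = (\<Sum>d | d dvd n. e d * (\<Sum>k | k dvd n div d. g k))"
    unfolding sum_distrib_left using assms fin' by (subst sum.Sigma) auto
  finally show ?thesis .
qed

section \<open>Circular words\<close>

text \<open>A word on a circle of length \<open>m\<close> is stored as an \<open>m\<close>-periodic
  function on the integers, so neighbours need no wrap-around, also for \<open>m\<close> = 1 and 2,
  where the two neighbours coincide.\<close>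

definition circular_words :: "nat \<Rightarrow> (int \<Rightarrow> bool) set" where
  "circular_words m = {w. (\<forall>t. w (t + int m) = w t) \<and> (\<forall>t. w t = (\<not> (w (t + 1) \<and> w (t - 1))))}"

text \<open>Walks of \<open>n\<close> steps in the graph whose vertices are pairs of consecutive
  letters. Successive pairs overlap in one letter, hence the length \<open>n + 2\<close>; the number
  of walks is an entry of the \<open>n\<close>-th power of the transfer matrix.\<close>

definition walks :: "nat \<Rightarrow> bool \<Rightarrow> bool \<Rightarrow> bool \<Rightarrow> bool \<Rightarrow> bool list set" where
  "walks n a b c d = {ys. length ys = n + 2
     \<and> (\<forall>i<n. ys ! Suc i = (\<not> (ys ! i \<and> ys ! Suc (Suc i))))
     \<and> ys ! 0 = a \<and> ys ! 1 = b \<and> ys ! n = c \<and> ys ! Suc n = d}"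

lemma finite_walks: "finite (walks n a b c d)"
  by (rule finite_subset[OF _ finite_lists_length_eq[of UNIV "n + 2"]]) (auto simp: walks_def)

lemma walks_Suc:
  "walks (Suc n) a b c d = (\<Union>e\<in>{e. b = (\<not> (a \<and> e))}. Cons a ` walks n b e c d)"
proof -
  have "ys \<in> walks (Suc n) a b c d \<longleftrightarrow>
      (\<exists>e zs. b = (\<not> (a \<and> e)) \<and> zs \<in> walks n b e c d \<and> ys = a # zs)" for ys
  proof (cases ys)
    case (Cons x zs)
    then show ?thesis
      by (auto simp: walks_def All_less_Suc2)
  qed (auto simp: walks_def)
  then show ?thesis
    by blast
qed

lemma card_walks_Suc:
  "card (walks (Suc n) a b c d) = (\<Sum>e | b = (\<not> (a \<and> e)). card (walks n b e c d))"
  unfolding walks_Suc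
proof (subst card_UN_disjoint)
  show "\<forall>i\<in>{e. b = (\<not> (a \<and> e))}. \<forall>j\<in>{e. b = (\<not> (a \<and> e))}. i \<noteq> j \<longrightarrow>
      (#) a ` walks n b i c d \<inter> (#) a ` walks n b j c d = {}"
    by (auto simp: walks_def)
qed (auto simp: finite_walks card_image)

lemma card_walks_0: "card (walks 0 a b c d) = (if a = c \<and> b = d then 1 else 0)"
proof -
  have "walks 0 a b c d = (if a = c \<and> b = d then {[a, b]} else {})"
    by (auto simp: walks_def length_Suc_conv)
  then show ?thesis
    by simp
qed

lemma card_walks_steps:
  "card (walks (Suc n) False False c d) = 0"
  "card (walks (Suc n) False True c d) = card (walks n True False c d) + card (walks n True True c d)"
  "card (walks (Suc n) True False c d) = card (walks n False True c d)"
  "card (walks (Suc n) True True c d) = card (walks n True False c d)"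
proof -
  \<comment> \<open>The admissible third letters \<open>e\<close>: any letter after 01, only 1 after
    10, only 0 after 11.\<close>
  have "{e. True} = {False, True}" "{e. e} = {True}" "{e. \<not> e} = {False}"
    by auto
  then show
    "card (walks (Suc n) False False c d) = 0"
    "card (walks (Suc n) False True c d) = card (walks n True False c d) + card (walks n True True c d)"
    "card (walks (Suc n) True False c d) = card (walks n False True c d)"
    "card (walks (Suc n) True True c d) = card (walks n True False c d)"
    by (simp_all add: card_walks_Suc UNIV_bool)
qed

text \<open>The Perrin numbers are the traces of the powers of the transfer matrix on the pairs
  01, 10, 11, whose characteristic polynomial is \<open>X\<^sup>3 - X - 1\<close>. The pair 00 has no successor.\<close>

lemma sum_card_closed_walks:
  "card (walks m False True False True) + card (walks m True False True False)
     + card (walks m True True True True) = perrin m"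
  \<comment> \<open>The sums for \<open>m + 3\<close> and \<open>m + 1\<close> both unfold to matrix
    entries at \<open>m\<close>, where the recurrence reads M^3 = M + I.\<close>
  by (induction m rule: perrin.induct) (simp_all add: card_walks_steps card_walks_0)

section \<open>Periodic functions on the integers\<close>

lemma periodic_add_mult:
  fixes y :: "int \<Rightarrow> 'a"
  assumes "\<And>t. y (t + p) = y t"
  shows "y (t + k * p) = y t"
proof (induction k rule: int_induct[where k = 0])
  case (step1 i)
  then show ?case
    using assms[of "t + i * p"] by (simp add: algebra_simps)
next
  case (step2 i)
  then show ?case
    using assms[of "t + (i - 1) * p"] by (simp add: algebra_simps)
qed simp

text \<open>Reduces later equalities between values of a periodic sequence to divisibility of index
  differences.\<close>

lemma periodic_cong:
  fixes y :: "int \<Rightarrow> 'a"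
  assumes "\<And>t. y (t + p) = y t" and "p dvd s - t"
  shows "y s = y t"
proof -
  obtain k where "s - t = p * k"
    using assms(2) by (elim dvdE)
  then have "s = t + k * p"
    by (simp add: algebra_simps)
  then show ?thesis
    using periodic_add_mult[of y p t k] assms(1) by simp
qed

section \<open>Circular words as closed walks\<close>

lemma closed_walk_mod:
  assumes "ys \<in> walks m a b a b" "m \<ge> 1" "i \<le> Suc m"
  shows "ys ! (i mod m) = ys ! i"
proof -
  consider "i < m" | "i = m" | "i = Suc m"
    using assms(3) by linarith
  then show ?thesis
  proof cases
    \<comment> \<open>For \<open>m = 1\<close> the index 2 reduces to 0, not to 1; there the closing
      conditions force \<open>a = b\<close>, so all three letters agree.\<close>
    case 3
    then show ?thesis
      using assms by (cases "m = 1") (auto simp: walks_def mod_Suc)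
  qed (use assms in \<open>auto simp: walks_def\<close>)
qed

text \<open>Cut the circle open and keep the two letters after one full turn: the \<open>m\<close>
  inner positions of the window of \<open>m + 2\<close> letters carry one NAND condition for each
  letter of the circle, and the last pair repeats the first. The inverse reads the window modulo
  \<open>m\<close>.\<close>

lemma bij_betw_circular_words:
  assumes "m \<ge> 1"
  shows "bij_betw (\<lambda>w. map (\<lambda>i. w (int i)) [0..<m + 2]) (circular_words m)
           (\<Union>(a, b)\<in>UNIV. walks m a b a b)"
proof (rule bij_betw_byWitness[where f' = "\<lambda>ys t. ys ! nat (t mod int m)"])
  have per: "w (t + int m) = w t" and rec: "w t = (\<not> (w (t + 1) \<and> w (t - 1)))"
    if "w \<in> circular_words m" for w t
    using that unfolding circular_words_def by blast+
  show "\<forall>w\<in>circular_words m.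
      (\<lambda>t. map (\<lambda>i. w (int i)) [0..<m + 2] ! nat (t mod int m)) = w"
  proof (intro ballI ext)
    fix w t assume w: "w \<in> circular_words m"
    have "nat (t mod int m) < m"
      using assms by (simp add: nat_less_iff)
    then have "map (\<lambda>i. w (int i)) [0..<m + 2] ! nat (t mod int m) = w (t mod int m)"
      using assms by (simp del: upt_Suc)
    also have "\<dots> = w t"
      by (rule periodic_cong[where p = "int m"]) (use per[OF w] in \<open>auto simp: mod_eq_dvd_iff[symmetric]\<close>)
    finally show "map (\<lambda>i. w (int i)) [0..<m + 2] ! nat (t mod int m) = w t" .
  qed
  show "\<forall>ys\<in>\<Union>(a, b)\<in>UNIV. walks m a b a b.
      map (\<lambda>i. ys ! nat (int i mod int m)) [0..<m + 2] = ys"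
  proof
    fix ys assume "ys \<in> (\<Union>(a, b)\<in>UNIV. walks m a b a b)"
    then obtain a b where ys: "ys \<in> walks m a b a b"
      by auto
    have "ys ! nat (int i mod int m) = ys ! i" if "i < m + 2" for i
      using closed_walk_mod[OF ys assms, of i] that by (simp flip: zmod_int)
    moreover have "length ys = m + 2"
      using ys by (simp add: walks_def)
    ultimately show "map (\<lambda>i. ys ! nat (int i mod int m)) [0..<m + 2] = ys"
      by (intro nth_equalityI) (simp_all del: upt_Suc)
  qed
  show "(\<lambda>w. map (\<lambda>i. w (int i)) [0..<m + 2]) ` circular_words m \<subseteq> (\<Union>(a, b)\<in>UNIV. walks m a b a b)"
  proof
    fix ys assume "ys \<in> (\<lambda>w. map (\<lambda>i. w (int i)) [0..<m + 2]) ` circular_words m"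
    then obtain w where w: "w \<in> circular_words m" and ys: "ys = map (\<lambda>i. w (int i)) [0..<m + 2]"
      by blast
    have nth: "ys ! i = w (int i)" if "i < m + 2" for i
      using that by (simp add: ys del: upt_Suc)
    have "w (int (Suc i)) = (\<not> (w (int i) \<and> w (int (Suc (Suc i)))))" for i
      using rec[OF w, of "int (Suc i)"] by (auto simp: add.commute)
    then have "ys \<in> walks m (w 0) (w 1) (w 0) (w 1)"
      using per[OF w, of 0] per[OF w, of 1] nth[of 0] nth[of 1] nth[of m] nth[of "Suc m"] nth
      unfolding walks_def by (auto simp: ys add.commute simp del: upt_Suc)
    then show "ys \<in> (\<Union>(a, b)\<in>UNIV. walks m a b a b)"
      by auto
  qed
  show "(\<lambda>ys t. ys ! nat (t mod int m)) ` (\<Union>(a, b)\<in>UNIV. walks m a b a b) \<subseteq> circular_words m"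
  proof
    fix w assume "w \<in> (\<lambda>ys t. ys ! nat (t mod int m)) ` (\<Union>(a, b)\<in>UNIV. walks m a b a b)"
    then obtain a b ys where ys: "ys \<in> walks m a b a b" and w: "w = (\<lambda>t. ys ! nat (t mod int m))"
      by auto
    have per: "w (t + int m) = w t" for t
      by (simp add: w)
    have nth: "w (t + int j) = ys ! (nat (t mod int m) + j)" if "j \<le> 2" for t j
    proof -
      define k where "k = nat (t mod int m)"
      have k: "k < m" "t mod int m = int k"
        using assms by (simp_all add: k_def nat_less_iff)
      have "(t + int j) mod int m = int ((k + j) mod m)"
        by (metis k(2) mod_add_left_eq of_nat_add zmod_int)
      then have "w (t + int j) = ys ! ((k + j) mod m)"
        by (simp add: w)
      also have "\<dots> = ys ! (k + j)"
        using closed_walk_mod[OF ys assms, of "k + j"] k that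
        by auto
      finally show ?thesis
        by (simp add: k_def)
    qed
    have rec: "w t = (\<not> (w (t + 1) \<and> w (t - 1)))" for t
    proof -
      \<comment> \<open>Based at \<open>t - 1\<close>, so that \<open>t\<close> is the middle of
        three consecutive list positions starting at \<open>i\<close>.\<close>
      define i where "i = nat ((t - 1) mod int m)"
      have "i < m"
        using assms by (simp add: i_def nat_less_iff)
      then have "ys ! Suc i = (\<not> (ys ! i \<and> ys ! Suc (Suc i)))"
        using ys by (simp add: walks_def)
      then show ?thesis
        using nth[of 0 "t - 1"] nth[of 1 "t - 1"] nth[of 2 "t - 1"]
        by (auto simp: i_def add.commute)
    qed
    show "w \<in> circular_words m"
      unfolding circular_words_def using per rec by blast
  qed
qed

text \<open>Classifying closed walks by their first pair gives the trace of the \<open>m\<close>-th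
  power of the transfer matrix.\<close>

lemma card_circular_words:
  assumes "m \<ge> 1"
  shows "card (circular_words m) = perrin m"
proof -
  have "card (circular_words m) = card (\<Union>(a, b)\<in>UNIV. walks m a b a b)"
    by (rule bij_betw_same_card[OF bij_betw_circular_words[OF assms]])
  also have "\<dots> = (\<Sum>(a, b)\<in>UNIV. card (walks m a b a b))"
    by (subst card_UN_disjoint) (auto simp: finite_walks case_prod_beta, auto simp: walks_def)
  also have "\<dots> = (\<Sum>a\<in>UNIV. \<Sum>b\<in>UNIV. card (walks m a b a b))"
    by (simp add: sum.cartesian_product)
  also have "\<dots> = perrin m"
    \<comment> \<open>The pair 00 is missing from the Perrin sum; its diagonal entry vanishes
      because \<open>m\<close> is positive, whereas it is 1 for \<open>m = 0\<close>.\<close>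
    using assms card_walks_steps(1)[of "m - 1" False False]
    by (simp add: UNIV_bool flip: sum_card_closed_walks)
  finally show "card (circular_words m) = perrin m" .
qed

section \<open>Periodic configurations as sequences\<close>

text \<open>The history of the intersection node over two-sided time: its inputs left that node
  \<open>l\<close> and \<open>r\<close> steps earlier.\<close>

definition nand_sequences :: "nat \<Rightarrow> nat \<Rightarrow> nat \<Rightarrow> (int \<Rightarrow> bool) set" where
  "nand_sequences p l r =
     {y. (\<forall>t. y (t + int p) = y t) \<and> (\<forall>t. y t = (\<not> (y (t - int l) \<and> y (t - int r))))}"

lemma nand_sequencesD:
  assumes "y \<in> nand_sequences p l r"
  shows "y (t + int p) = y t" and "y t = (\<not> (y (t - int l) \<and> y (t - int r)))"
  using assms unfolding nand_sequences_def by blast+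

text \<open>The node at distance \<open>i\<close> from the intersection carries the value that the intersection
  had \<open>i\<close> steps earlier.\<close>

definition config_at :: "nat \<Rightarrow> nat \<Rightarrow> (int \<Rightarrow> bool) \<Rightarrow> int \<Rightarrow> bool list" where
  "config_at l r y t =
     map (\<lambda>i. if i < l then y (t - int i) else y (t - 1 - int (i - l))) [0..<l + r - 1]"

lemma length_config_at [simp]: "length (config_at l r y t) = l + r - 1"
  by (simp add: config_at_def)

lemma nth_config_at:
  "i < l + r - 1 \<Longrightarrow>
     config_at l r y t ! i = (if i < l then y (t - int i) else y (t - 1 - int (i - l)))"
  by (simp add: config_at_def)

lemma length_dbac_step [simp]: "length (dbac_step l r x) = l + r - 1"
  by (simp add: dbac_step_def)

lemma nth_dbac_step:
  assumes "l \<ge> 1" "r \<ge> 1" "length x = l + r - 1" "i < l + r - 1"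
  shows "dbac_step l r x ! i =
    (if i = 0 then \<not> (x ! (l - 1) \<and> (if r = 1 then x ! 0 else x ! (l + r - 2)))
     else if i = l then x ! 0 else x ! (i - 1))"
proof -
  have "last (left_part l x) = x ! (l - 1)"
    using assms by (subst left_part_def, subst last_conv_nth) auto
  moreover have "last (right_part l x) = (if r = 1 then x ! 0 else x ! (l + r - 2))"
    using assms by (auto simp: right_part_def last_conv_nth numeral_2_eq_2)
  ultimately show ?thesis
    using assms by (simp add: dbac_step_def)
qed

text \<open>Every other node copies its predecessor, which raises the delay by one and compensates
  the shift of time; at the intersection the step is the recursion for \<open>y\<close> at
  \<open>t + 1\<close>.\<close>

lemma dbac_step_config_at:
  assumes "l \<ge> 1" "r \<ge> 1" and y: "y \<in> nand_sequences p l r"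
  shows "dbac_step l r (config_at l r y t) = config_at l r y (t + 1)"
proof (rule nth_equalityI)
  fix i assume "i < length (dbac_step l r (config_at l r y t))"
  then have i: "i < l + r - 1"
    by simp
  consider "i = 0" | "0 < i" "i < l" | "i = l" | "l < i"
    by linarith
  then show "dbac_step l r (config_at l r y t) ! i = config_at l r y (t + 1) ! i"
  proof cases
    case 1
    have "config_at l r y t ! (l - 1) = y (t + 1 - int l)"
      using assms by (simp add: nth_config_at of_nat_diff algebra_simps)
    \<comment> \<open>For \<open>r = 1\<close> the second input is node 0 itself, with delay 0;
      otherwise it is the last node, with delay \<open>r - 1\<close>. Either way its value dates
      from \<open>r\<close> steps before \<open>t + 1\<close>.\<close>
    moreover have "(if r = 1 then config_at l r y t ! 0 else config_at l r y t ! (l + r - 2))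
        = y (t + 1 - int r)"
      using assms by (auto simp: nth_config_at of_nat_diff algebra_simps)
    ultimately show ?thesis
      using 1 i assms nand_sequencesD(2)[OF y, of "t + 1"] by (simp add: nth_dbac_step nth_config_at)
  next
    case 2
    then have "i - 1 < l"
      by simp
    then show ?thesis
      using 2 i assms by (simp add: nth_dbac_step nth_config_at of_nat_diff algebra_simps)
  next
    case 3
    then show ?thesis
      using i assms by (simp add: nth_dbac_step nth_config_at)
  next
    case 4
    then have "i - l = Suc (i - 1 - l)" "\<not> i - 1 < l"
      by auto
    then show ?thesis
      using 4 i assms by (simp add: nth_dbac_step nth_config_at algebra_simps)
  qed
qed simp

lemma funpow_dbac_step_config_at:
  assumes "l \<ge> 1" "r \<ge> 1" "y \<in> nand_sequences p l r"
  shows "(dbac_step l r ^^ k) (config_at l r y t) = config_at l r y (t + int k)"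
  by (induction k) (simp_all add: dbac_step_config_at[OF assms] add_ac)

lemma config_at_cong:
  assumes "\<And>s. y (s + c) = y s"
  shows "config_at l r y (t + c) = config_at l r y t"
proof -
  have shift: "y (t + c - int i) = y (t - int i)" "y (t + c - 1 - int i) = y (t - 1 - int i)" for i
    using assms[of "t - int i"] assms[of "t - 1 - int i"] by (simp_all add: algebra_simps)
  show ?thesis
    unfolding config_at_def by (simp only: shift)
qed

lemma config_at_mem:
  assumes "l \<ge> 1" "r \<ge> 1" "p \<ge> 1" "y \<in> nand_sequences p l r"
  shows "config_at l r y t \<in> configs l r" and "has_period l r p (config_at l r y t)"
  using assms by (simp_all add: configs_def has_period_def funpow_dbac_step_config_at
      config_at_cong nand_sequencesD(1))

text \<open>Running the circuit for \<open>t mod p\<close> steps brings \<open>y t\<close> to node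
  0, so the initial configuration determines all of \<open>y\<close>.\<close>

lemma config_at_inj:
  assumes "l \<ge> 1" "r \<ge> 1" "p \<ge> 1" and y: "y \<in> nand_sequences p l r" and z: "z \<in> nand_sequences p l r"
    and eq: "config_at l r y 0 = config_at l r z 0"
  shows "y = z"
proof
  fix t
  define k where "k = nat (t mod int p)"
  have k: "int k = t mod int p"
    using assms(3) by (simp add: k_def)
  have "y t = y (int k)" "z t = z (int k)"
    by (rule periodic_cong[where p = "int p"]; use nand_sequencesD(1)[OF y] nand_sequencesD(1)[OF z] in
        \<open>simp add: k mod_eq_dvd_iff[symmetric]\<close>)+
  moreover have "config_at l r y (int k) ! 0 = config_at l r z (int k) ! 0"
    using funpow_dbac_step_config_at[OF assms(1,2) y, of k 0]
      funpow_dbac_step_config_at[OF assms(1,2) z, of k 0] eq by simp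
  ultimately show "y t = z t"
    using assms(1,2) by (simp add: nth_config_at)
qed

text \<open>The witness \<open>y\<close> records the states of node 0 along the orbit of
  \<open>x\<close>.\<close>

lemma config_at_surj:
  assumes "l \<ge> 1" "r \<ge> 1" "x \<in> configs l r" "has_period l r p x"
  shows "\<exists>y\<in>nand_sequences p l r. config_at l r y 0 = x"
proof -
  let ?F = "dbac_step l r"
  \<comment> \<open>Reducing time modulo \<open>p\<close> also gives \<open>x\<close> a periodic
    past, without inverting the step.\<close>
  define X where "X t = (?F ^^ nat (t mod int p)) x" for t
  define y where "y t = X t ! 0" for t
  have p: "p \<ge> 1" "(?F ^^ p) x = x"
    using assms(4) by (simp_all add: has_period_def)
  have len: "length (X t) = l + r - 1" for t
    using assms(3) by (cases "nat (t mod int p)") (simp_all add: X_def configs_def)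
  have X_step: "X (t + 1) = ?F (X t)" for t
  proof -
    define k where "k = nat (t mod int p)"
    have k: "t mod int p = int k"
      using p(1) by (simp add: k_def)
    have "(t + 1) mod int p = int (Suc k mod p)"
      by (metis add.commute k mod_add_left_eq of_nat_Suc zmod_int)
    then show ?thesis
      using funpow_mod_eq[OF p(2), of "Suc k"] by (simp add: X_def k)
  qed
  have X_step': "X t = ?F (X (t - 1))" for t
    using X_step[of "t - 1"] by simp
  have left: "X t ! i = y (t - int i)" if "i < l" for i t
    using that
  proof (induction i arbitrary: t)
    case (Suc i)
    have "X t ! Suc i = X (t - 1) ! i"
      unfolding X_step'[of t] using Suc.prems assms(1,2) by (subst nth_dbac_step) (auto simp: len)
    then show ?case
      using Suc by (simp add: algebra_simps)
  qed (simp add: y_def)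
  \<comment> \<open>Node \<open>l\<close> copies node 0, so the delay along the right-circuit
    restarts at 1.\<close>
  have right: "X t ! (l + j) = y (t - 1 - int j)" if "j < r - 1" for j t
    using that
  proof (induction j arbitrary: t)
    case 0
    have "X t ! l = X (t - 1) ! 0"
      unfolding X_step'[of t] using 0 assms(1,2) by (subst nth_dbac_step) (auto simp: len)
    then show ?case
      by (simp add: y_def)
  next
    case (Suc j)
    have "X t ! (l + Suc j) = X (t - 1) ! (l + j)"
      unfolding X_step'[of t] using Suc.prems assms(1,2) by (subst nth_dbac_step) (auto simp: len)
    then show ?case
      using Suc by (simp add: algebra_simps)
  qed
  have "y (t + int p) = y t" for t
    by (simp add: y_def X_def)
  moreover have "y t = (\<not> (y (t - int l) \<and> y (t - int r)))" for t
  proof -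
    have "X (t - 1) ! (l - 1) = y (t - int l)"
      using left[of "l - 1" "t - 1"] assms(1) by (simp add: of_nat_diff)
    moreover have "(if r = 1 then X (t - 1) ! 0 else X (t - 1) ! (l + r - 2)) = y (t - int r)"
    proof (cases "r = 1")
      case False
      then have "l + r - 2 = l + (r - 2)"
        using assms(2) by simp
      then show ?thesis
        using right[of "r - 2" "t - 1"] False assms(2) by (simp add: of_nat_diff)
    qed (simp add: y_def)
    ultimately show ?thesis
      unfolding y_def[of t] X_step'[of t] using assms(1,2) by (subst nth_dbac_step) (auto simp: len)
  qed
  ultimately have "y \<in> nand_sequences p l r"
    unfolding nand_sequences_def by blast
  moreover have "config_at l r y 0 = X 0"
  proof (rule nth_equalityI)
    fix i assume "i < length (config_at l r y 0)"
    then show "config_at l r y 0 ! i = X 0 ! i"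
      using left[of i 0] right[of "i - l" 0] by (auto simp: nth_config_at)
  qed (simp add: len)
  ultimately show ?thesis
    by (auto simp: X_def)
qed

lemma num_period_configs_eq_card_nand_sequences:
  assumes "l \<ge> 1" "r \<ge> 1" "p \<ge> 1"
  shows "num_period_configs p l r = card (nand_sequences p l r)"
proof -
  have "bij_betw (\<lambda>y. config_at l r y 0) (nand_sequences p l r) {x \<in> configs l r. has_period l r p x}"
    unfolding bij_betw_def
  proof (intro conjI inj_onI)
    show "(\<lambda>y. config_at l r y 0) ` nand_sequences p l r = {x \<in> configs l r. has_period l r p x}"
      using config_at_mem[OF assms] config_at_surj[OF assms(1,2)] by (auto simp: image_iff) metis
  qed (rule config_at_inj[OF assms])
  then show ?thesis
    by (simp add: num_period_configs_def bij_betw_same_card)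
qed

text \<open>A value 0 forces the values \<open>l\<close> and \<open>r\<close> steps later to be 1, and hence the value \<open>l + r\<close>
  steps later to be 0; on a periodic sequence this map of the set of zeros to itself is onto.\<close>

lemma nand_sequences_period_add:
  assumes "p \<ge> 1" and y: "y \<in> nand_sequences p l r"
  shows "y (t + int (l + r)) = y t"
proof -
  have zero: "\<not> y (t + int (l + r))" if "\<not> y t" for t
    using that nand_sequencesD(2)[OF y, of "t + int (l + r)"] nand_sequencesD(2)[OF y, of "t + int l"]
      nand_sequencesD(2)[OF y, of "t + int r"] by simp
  have zeros: "\<not> y (t + int k * int (l + r))" if "\<not> y t" for t k
  proof (induction k)
    case (Suc k)
    then show ?case
      using zero[of "t + int k * int (l + r)"] by (simp add: algebra_simps)
  qed (use that in simp)
  have "\<not> y t" if "\<not> y (t + int (l + r))"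
  proof -
    \<comment> \<open>Together with the first shift these are \<open>p\<close> shifts by
      \<open>l + r\<close>, which leave a \<open>p\<close>-periodic sequence unchanged.\<close>
    have "y (t + int (l + r) + int (p - 1) * int (l + r)) = y t"
      by (rule periodic_cong[where p = "int p"])
        (use assms(1) nand_sequencesD(1)[OF y] in \<open>auto simp: of_nat_diff algebra_simps\<close>)
    then show ?thesis
      using zeros[OF that, of "p - 1"] by simp
  qed
  then show ?thesis
    using zero[of t] by blast
qed

text \<open>Confines the attractor periods to divisors of \<open>l + r\<close>: the encoding
  sequence repeats after \<open>l + r\<close> steps, and it determines the configuration.\<close>

lemma has_period_add:
  assumes "l \<ge> 1" "r \<ge> 1" "x \<in> configs l r" "has_period l r p x"
  shows "has_period l r (l + r) x"
proof -
  obtain y where y: "y \<in> nand_sequences p l r" and x: "x = config_at l r y 0"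
    using config_at_surj[OF assms] by blast
  have "p \<ge> 1"
    using assms(4) by (simp add: has_period_def)
  then show ?thesis
    using assms(1,2) config_at_cong[of y "int (l + r)" l r 0] nand_sequences_period_add[OF _ y]
    by (simp add: has_period_def x funpow_dbac_step_config_at[OF assms(1,2) y] del: of_nat_add)
qed

text \<open>Modulo \<open>p\<close> the two shifts \<open>l\<close> and \<open>r\<close> are opposite, so the recursion decouples along the
  \<open>gcd r p\<close> cosets of the subgroup generated by \<open>r\<close>.\<close>

lemma bij_betw_nand_sequences:
  assumes "p \<ge> 1" "p dvd l + r"
  defines "d \<equiv> gcd r p"
  shows "bij_betw (\<lambda>y. \<lambda>j\<in>{..<d}. \<lambda>s. y (int j + s * int r)) (nand_sequences p l r)
           (PiE {..<d} (\<lambda>_. circular_words (p div d)))"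
proof -
  define m where "m = p div d"
  define c where "c = r div d"
  have d: "d \<ge> 1"
    using assms(1) by (simp add: d_def Suc_le_eq)
  have p: "p = m * d" and r: "r = c * d"
    by (simp_all add: m_def c_def d_def)
  have "coprime c m"
    using assms(1) by (simp add: c_def m_def d_def div_gcd_coprime)
  \<comment> \<open>\<open>u\<close> inverts \<open>r div d\<close> modulo \<open>m\<close>, so
    that, with \<open>j = t mod d\<close>, the congruence of \<open>j + s * r\<close> and
    \<open>t\<close> modulo \<open>p\<close> is solved by \<open>s = (t div d) * u\<close>.\<close>
  then obtain u where u: "[int c * u = 1] (mod int m)"
    using cong_solve_coprime_int[of "int c" "int m"] by auto
  then have u_dvd: "int m dvd int c * u - 1"
    by (simp add: cong_iff_dvd_diff)
  define glue where
    "glue w t = w (nat (t mod int d)) ((t div int d) * u)" for w :: "nat \<Rightarrow> int \<Rightarrow> bool" and t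
  have wper: "w j (s + int m) = w j s" and wrec: "w j s = (\<not> (w j (s + 1) \<and> w j (s - 1)))"
    if "w \<in> PiE {..<d} (\<lambda>_. circular_words m)" "j < d" for w j s
    using PiE_mem[OF that(1), of j] that(2) unfolding circular_words_def by blast+
  show ?thesis
    unfolding m_def[symmetric]
  proof (rule bij_betw_byWitness[where f' = glue])
    show "\<forall>y\<in>nand_sequences p l r. glue (\<lambda>j\<in>{..<d}. \<lambda>s. y (int j + s * int r)) = y"
    proof (intro ballI ext)
      fix y t assume y: "y \<in> nand_sequences p l r"
      have "glue (\<lambda>j\<in>{..<d}. \<lambda>s. y (int j + s * int r)) t = y (t mod int d + t div int d * u * int r)"
        using d by (simp add: glue_def nat_less_iff)
      also have "\<dots> = y t"
      proof (rule periodic_cong[where p = "int p"])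
        have "t mod int d + t div int d * u * int r - t
            = t mod int d + t div int d * u * int r - (t div int d * int d + t mod int d)"
          by simp
        also have "\<dots> = t div int d * ((int c * u - 1) * int d)"
          by (simp add: r algebra_simps)
        finally show "int p dvd t mod int d + t div int d * u * int r - t"
          using u_dvd by (simp add: p mult_dvd_mono)
      qed (rule nand_sequencesD(1)[OF y])
      finally show "glue (\<lambda>j\<in>{..<d}. \<lambda>s. y (int j + s * int r)) t = y t" .
    qed
    show "\<forall>w\<in>PiE {..<d} (\<lambda>_. circular_words m). (\<lambda>j\<in>{..<d}. \<lambda>s. glue w (int j + s * int r)) = w"
    proof
      fix w assume w: "w \<in> PiE {..<d} (\<lambda>_. circular_words m)"
      have glue: "glue w (int j + s * int r) = w j s" if j: "j < d" for j s
      proof -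
        have "int j + s * int r = int j + (s * int c) * int d"
          by (simp add: r)
        then have "(int j + s * int r) mod int d = int j" "(int j + s * int r) div int d = s * int c"
          using j d by (simp_all only: mod_mult_self1 div_mult_self1) simp_all
        then have "glue w (int j + s * int r) = w j (s * int c * u)"
          by (simp add: glue_def)
        also have "\<dots> = w j s"
        proof (rule periodic_cong[where p = "int m"])
          have "s * int c * u - s = s * (int c * u - 1)"
            by (simp add: algebra_simps)
          then show "int m dvd s * int c * u - s"
            using u_dvd by simp
        qed (rule wper[OF w j])
        finally show ?thesis .
      qed
      show "(\<lambda>j\<in>{..<d}. \<lambda>s. glue w (int j + s * int r)) = w"
        using PiE_restrict[OF w] by (simp add: glue cong: restrict_cong)
    qed
    show "(\<lambda>y. \<lambda>j\<in>{..<d}. \<lambda>s. y (int j + s * int r)) ` nand_sequences p l r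
        \<subseteq> PiE {..<d} (\<lambda>_. circular_words m)"
    proof (intro image_subsetI restrict_PiE_iff[THEN iffD2] ballI)
      fix y j assume y: "y \<in> nand_sequences p l r"
      \<comment> \<open>\<open>m * r = c * p\<close>, so a full turn of the word is a multiple of
        the period.\<close>
      have "y (int j + (s + int m) * int r) = y (int j + s * int r)" for s
        by (rule periodic_cong[where p = "int p"])
          (use nand_sequencesD(1)[OF y] in \<open>simp_all add: p r algebra_simps\<close>)
      moreover have "y (int j + s * int r)
          = (\<not> (y (int j + (s + 1) * int r) \<and> y (int j + (s - 1) * int r)))" for s
      proof -
        \<comment> \<open>Since \<open>p\<close> divides \<open>l + r\<close>, going back by
          \<open>l\<close> amounts to going forward by \<open>r\<close>, to the next letter.\<close>
        have "y (int j + s * int r - int l) = y (int j + (s + 1) * int r)"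
        proof (rule periodic_cong[where p = "int p"])
          have "int j + s * int r - int l - (int j + (s + 1) * int r) = - int (l + r)"
            by (simp add: algebra_simps)
          then show "int p dvd int j + s * int r - int l - (int j + (s + 1) * int r)"
            using assms(2) by (simp only: dvd_minus_iff int_dvd_int_iff)
        qed (rule nand_sequencesD(1)[OF y])
        then show ?thesis
          using nand_sequencesD(2)[OF y, of "int j + s * int r"] by (simp add: algebra_simps)
      qed
      ultimately show "(\<lambda>s. y (int j + s * int r)) \<in> circular_words m"
        unfolding circular_words_def by blast
    qed
    show "glue ` PiE {..<d} (\<lambda>_. circular_words m) \<subseteq> nand_sequences p l r"
    proof (rule image_subsetI)
      fix w assume w: "w \<in> PiE {..<d} (\<lambda>_. circular_words m)"
      have less: "nat (t mod int d) < d" for t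
        using d by (simp add: nat_less_iff)
      have shift: "glue w (t + k * int d) = w (nat (t mod int d)) (t div int d * u + k * u)" for t k
        using d by (simp add: glue_def algebra_simps)
      have per: "glue w (t + int p) = glue w t" for t
      proof -
        have "glue w (t + int p) = w (nat (t mod int d)) (t div int d * u + int m * u)"
          using shift[of t "int m"] by (simp add: p)
        also have "\<dots> = w (nat (t mod int d)) (t div int d * u)"
          by (rule periodic_cong[where p = "int m"]) (use wper[OF w less] in simp_all)
        finally show ?thesis
          by (simp add: glue_def)
      qed
      \<comment> \<open>By the choice of \<open>u\<close>, adding \<open>r = c * d\<close> advances
        by \<open>c * u\<close>, that is by one letter modulo \<open>m\<close>.\<close>
      have plus: "glue w (t + int r) = w (nat (t mod int d)) (t div int d * u + 1)" for t
      proof -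
        have "glue w (t + int r) = w (nat (t mod int d)) (t div int d * u + int c * u)"
          using shift[of t "int c"] by (simp add: r)
        also have "\<dots> = w (nat (t mod int d)) (t div int d * u + 1)"
          by (rule periodic_cong[where p = "int m"]) (use wper[OF w less] u_dvd in simp_all)
        finally show ?thesis .
      qed
      have minus: "glue w (t - int r) = w (nat (t mod int d)) (t div int d * u - 1)" for t
      proof -
        have "glue w (t - int r) = w (nat (t mod int d)) (t div int d * u - int c * u)"
          using shift[of t "- int c"] by (simp add: r)
        also have "\<dots> = w (nat (t mod int d)) (t div int d * u - 1)"
        proof (rule periodic_cong[where p = "int m"])
          have "t div int d * u - int c * u - (t div int d * u - 1) = - (int c * u - 1)"
            by simp
          then show "int m dvd t div int d * u - int c * u - (t div int d * u - 1)"
            using u_dvd by (simp only: dvd_minus_iff)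
        qed (rule wper[OF w less])
        finally show ?thesis .
      qed
      have "glue w (t - int l) = glue w (t + int r)" for t
      proof (rule periodic_cong[where p = "int p"])
        have "t - int l - (t + int r) = - int (l + r)"
          by simp
        then show "int p dvd t - int l - (t + int r)"
          using assms(2) by (simp only: dvd_minus_iff int_dvd_int_iff)
      qed (rule per)
      then have "glue w t = (\<not> (glue w (t - int l) \<and> glue w (t - int r)))" for t
        using plus[of t] minus[of t] wrec[OF w less[of t], of "t div int d * u"]
        by (simp add: glue_def)
      then show "glue w \<in> nand_sequences p l r"
        unfolding nand_sequences_def using per by blast
    qed
  qed
qed

text \<open>The independent circular words are each counted by a Perrin number. All divisors of
  \<open>l + r\<close> are covered, as the divisor sums require; if \<open>p\<close> divides
  \<open>r\<close>, the words have length 1 and the count is 0.\<close>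

lemma num_period_configs_eq_perrin:
  assumes "l \<ge> 1" "r \<ge> 1" "p dvd l + r"
  shows "num_period_configs p l r = perrin (p div gcd (gcd l r) p) ^ gcd (gcd l r) p"
proof -
  have p: "p \<ge> 1"
    using assms by (cases "p = 0") auto
  \<comment> \<open>As \<open>p\<close> divides \<open>l + r\<close>, common divisors of
    \<open>r\<close> and \<open>p\<close> divide \<open>l\<close>, so \<open>gcd r p\<close> is the
    symmetric \<open>gcd (gcd l r) p\<close>.\<close>
  have "gcd r p dvd l"
    using assms(3) by (metis dvd_add_left_iff dvd_trans gcd_dvd1 gcd_dvd2)
  then have gcd: "gcd (gcd l r) p = gcd r p"
    by (intro dvd_antisym) (auto intro: dvd_trans[OF gcd_dvd1])
  have "p div gcd r p \<ge> 1"
    using p by (simp add: Suc_le_eq div_greater_zero_iff dvd_imp_le)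
  then have "card (PiE {..<gcd r p} (\<lambda>_. circular_words (p div gcd r p)))
      = perrin (p div gcd r p) ^ gcd r p"
    by (simp add: card_PiE card_circular_words)
  then show ?thesis
    using num_period_configs_eq_card_nand_sequences[OF assms(1,2) p]
      bij_betw_same_card[OF bij_betw_nand_sequences[OF p assms(3)]] by (simp add: gcd)
qed

section \<open>Attractors\<close>

definition exact_period_configs :: "nat \<Rightarrow> nat \<Rightarrow> nat \<Rightarrow> bool list set" where
  "exact_period_configs p l r = {x \<in> configs l r. has_exact_period l r p x}"

lemma finite_exact_period_configs: "finite (exact_period_configs p l r)"
  by (rule finite_subset[OF _ finite_lists_length_eq[of UNIV "l + r - 1"]])
    (auto simp: exact_period_configs_def configs_def)

section \<open>Exact periods\<close>

lemma funpow_dbac_step_in_configs: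
  "x \<in> configs l r \<Longrightarrow> (dbac_step l r ^^ k) x \<in> configs l r"
  by (cases k) (simp_all add: configs_def)

text \<open>The remainder \<open>p mod q\<close> also leads back to \<open>x\<close>, and minimality
  of \<open>q\<close> makes it 0.\<close>

lemma has_period_iff_dvd:
  assumes "has_exact_period l r q x"
  shows "has_period l r p x \<longleftrightarrow> p \<ge> 1 \<and> q dvd p"
proof -
  let ?F = "dbac_step l r"
  have q: "q \<ge> 1" "(?F ^^ q) x = x" and least: "\<And>d. d < q \<Longrightarrow> \<not> has_period l r d x"
    using assms by (simp_all add: has_exact_period_def has_period_def)
  have mod: "(?F ^^ p) x = (?F ^^ (p mod q)) x"
    by (simp add: funpow_mod_eq[OF q(2)])
  show ?thesis
  proof
    assume per: "has_period l r p x"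
    then have "\<not> p mod q \<ge> 1"
      using least[of "p mod q"] mod q(1) by (simp add: has_period_def)
    then show "p \<ge> 1 \<and> q dvd p"
      using per by (simp add: has_period_def dvd_eq_mod_eq_0)
  qed (simp add: has_period_def mod dvd_eq_mod_eq_0)
qed

lemma has_period_imp_exact:
  assumes "has_period l r p x"
  obtains q where "has_exact_period l r q x"
proof
  show "has_exact_period l r (LEAST q. has_period l r q x) x"
    unfolding has_exact_period_def using LeastI[of "\<lambda>q. has_period l r q x", OF assms] not_less_Least
    by blast
qed

lemma has_exact_period_unique:
  assumes "has_exact_period l r p x" "has_exact_period l r q x"
  shows "p = q"
  using assms by (metis has_exact_period_def linorder_neqE_nat)

lemma num_period_configs_eq_sum:
  assumes "p \<ge> 1"
  shows "num_period_configs p l r = (\<Sum>q | q dvd p. card (exact_period_configs q l r))"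
proof -
  have "{x \<in> configs l r. has_period l r p x} = (\<Union>q\<in>{q. q dvd p}. exact_period_configs q l r)"
    using assms by (auto simp: exact_period_configs_def has_period_iff_dvd)
      (metis has_period_iff_dvd has_period_imp_exact)
  moreover have "card \<dots> = (\<Sum>q | q dvd p. card (exact_period_configs q l r))"
    using assms has_exact_period_unique
    by (intro card_UN_disjoint) (auto simp: finite_exact_period_configs, auto simp: exact_period_configs_def)
  ultimately show ?thesis
    by (simp add: num_period_configs_def)
qed

text \<open>On a periodic orbit any number of steps can be undone by running on, so all points share
  their periods.\<close>

lemma has_period_funpow_iff:
  assumes "has_period l r q x"
  shows "has_period l r p ((dbac_step l r ^^ k) x) \<longleftrightarrow> has_period l r p x"
proof -
  let ?F = "dbac_step l r"
  have q: "q \<ge> 1" "(?F ^^ q) x = x"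
    using assms by (simp_all add: has_period_def)
  \<comment> \<open>Completes \<open>k\<close> steps to \<open>k\<close> full turns of length
    \<open>q\<close>.\<close>
  define j where "j = k * (q - 1)"
  have jk: "j + k = k * q"
    using q(1) by (cases q) (simp_all add: j_def)
  have "(?F ^^ (k * q)) x = x"
    using funpow_mod_eq[OF q(2), of "k * q"] by simp
  then have return: "(?F ^^ j) ((?F ^^ k) x) = x"
    by (metis jk comp_apply funpow_add)
  have comm: "(?F ^^ a) ((?F ^^ b) z) = (?F ^^ b) ((?F ^^ a) z)" for a b z
    by (metis add.commute comp_apply funpow_add)
  have "(?F ^^ p) ((?F ^^ k) x) = (?F ^^ k) x \<longleftrightarrow> (?F ^^ p) x = x"
    by (metis return comm)
  then show ?thesis
    by (simp add: has_period_def)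
qed

lemma has_exact_period_funpow:
  assumes "has_exact_period l r q x"
  shows "has_exact_period l r q ((dbac_step l r ^^ k) x)"
proof -
  have "has_period l r q x"
    using assms by (simp add: has_exact_period_def)
  then show ?thesis
    using assms by (simp add: has_exact_period_def has_period_funpow_iff[of l r q x])
qed

section \<open>Orbits as classes of configurations\<close>

lemma self_in_orbit:
  assumes "has_exact_period l r q x"
  shows "x \<in> orbit (dbac_step l r) x"
  using assms by (auto simp: has_exact_period_def has_period_def orbit_altdef intro!: exI[of _ q])

text \<open>The first \<open>q\<close> iterates are distinct: if two agreed, their distance would be
  a period below \<open>q\<close> of a point with exact period \<open>q\<close>.\<close>

lemma card_orbit:
  assumes "has_exact_period l r q x"
  shows "card (orbit (dbac_step l r) x) = q"
proof -
  let ?F = "dbac_step l r"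
  have q: "q \<ge> 1" "(?F ^^ q) x = x"
    using assms by (simp_all add: has_exact_period_def has_period_def)
  have neq: "(?F ^^ i) x \<noteq> (?F ^^ j) x" if "i < j" "j < q" for i j
  proof
    assume eq: "(?F ^^ i) x = (?F ^^ j) x"
    have "(?F ^^ (j - i)) ((?F ^^ i) x) = (?F ^^ j) x"
      using that(1) by (simp flip: funpow_add comp_apply[of "?F ^^ (j - i)" "?F ^^ i"])
    then have "has_period l r (j - i) ((?F ^^ i) x)"
      using that eq by (simp add: has_period_def)
    then show False
      using has_exact_period_funpow[OF assms, of i] that by (simp add: has_exact_period_def)
  qed
  have "inj_on (\<lambda>i. (?F ^^ i) x) {..<q}"
    by (rule inj_onI) (metis lessThan_iff linorder_neqE_nat neq)
  moreover have "orbit ?F x = (\<lambda>i. (?F ^^ i) x) ` {..<q}"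
    using q by (subst orbit_altdef_bounded[of q]) auto
  ultimately show ?thesis
    by (simp add: card_image)
qed

lemma orbit_subset_exact_period_configs:
  assumes "x \<in> exact_period_configs q l r"
  shows "orbit (dbac_step l r) x \<subseteq> exact_period_configs q l r"
proof
  fix z assume "z \<in> orbit (dbac_step l r) x"
  then obtain n where "z = (dbac_step l r ^^ n) x"
    by (auto simp: orbit_altdef)
  then show "z \<in> exact_period_configs q l r"
    using assms has_exact_period_funpow funpow_dbac_step_in_configs
    by (simp add: exact_period_configs_def)
qed

lemma attractors_of_period_altdef:
  "attractors_of_period q l r = orbit (dbac_step l r) ` exact_period_configs q l r"
  by (simp add: attractors_of_period_def exact_period_configs_def)

lemma Union_attractors_of_period:
  "\<Union> (attractors_of_period q l r) = exact_period_configs q l r"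
proof
  show "\<Union> (attractors_of_period q l r) \<subseteq> exact_period_configs q l r"
    unfolding attractors_of_period_altdef using orbit_subset_exact_period_configs by blast
  show "exact_period_configs q l r \<subseteq> \<Union> (attractors_of_period q l r)"
  proof
    fix x assume x: "x \<in> exact_period_configs q l r"
    then have "x \<in> orbit (dbac_step l r) x"
      unfolding exact_period_configs_def using self_in_orbit by blast
    then show "x \<in> \<Union> (attractors_of_period q l r)"
      unfolding attractors_of_period_altdef using x by blast
  qed
qed

lemma card_attractor:
  "c \<in> attractors_of_period q l r \<Longrightarrow> card c = q"
  unfolding attractors_of_period_def using card_orbit by blast

lemma finite_attractors_of_period: "finite (attractors_of_period q l r)"
  by (simp add: attractors_of_period_altdef finite_exact_period_configs)

text \<open>Orbits with a common point coincide, so they partition the configurations of exact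
  period \<open>q\<close> into classes of \<open>q\<close> elements.\<close>

lemma period_mult_num_attractors_of_period:
  "q * num_attractors_of_period q l r = card (exact_period_configs q l r)"
proof -
  let ?F = "dbac_step l r"
  have orbit_eq: "orbit ?F x = orbit ?F z"
    if "has_exact_period l r q x" "z \<in> orbit ?F x" for x z
    using that self_in_orbit orbit_swap orbit_trans by (metis subsetI subset_antisym)
  have disjoint: "c1 \<inter> c2 = {}"
    if "c1 \<in> attractors_of_period q l r" "c2 \<in> attractors_of_period q l r" "c1 \<noteq> c2" for c1 c2
    using that orbit_eq unfolding attractors_of_period_def by blast
  show ?thesis
    unfolding num_attractors_of_period_def Union_attractors_of_period[symmetric]
  proof (rule card_partition)
    show "finite (\<Union> (attractors_of_period q l r))"
      by (simp add: Union_attractors_of_period finite_exact_period_configs)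
  qed (fact finite_attractors_of_period card_attractor disjoint)+
qed

lemma exact_period_dvd:
  assumes "l \<ge> 1" "r \<ge> 1" "x \<in> exact_period_configs p l r"
  shows "p dvd l + r"
proof -
  have x: "x \<in> configs l r" "has_exact_period l r p x"
    using assms(3) by (simp_all add: exact_period_configs_def)
  then have "has_period l r (l + r) x"
    using has_period_add[OF assms(1,2) x(1), of p] x(2) by (simp add: has_exact_period_def)
  then show ?thesis
    using has_period_iff_dvd[OF x(2)] by simp
qed

section \<open>Counting attractors\<close>

lemma num_attractors_eq_sum:
  assumes "l \<ge> 1" "r \<ge> 1"
  shows "num_attractors l r = (\<Sum>p | p dvd l + r. num_attractors_of_period p l r)"
proof -
  have "(\<Union>p\<in>{1..}. attractors_of_period p l r) = (\<Union>p\<in>{p. p dvd l + r}. attractors_of_period p l r)"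
  proof (rule antisym)
    show "(\<Union>p\<in>{1..}. attractors_of_period p l r) \<subseteq> (\<Union>p\<in>{p. p dvd l + r}. attractors_of_period p l r)"
      unfolding attractors_of_period_altdef using exact_period_dvd[OF assms] by blast
    have "p \<ge> 1" if "p dvd l + r" for p
      using that assms by (cases "p = 0") auto
    then show "(\<Union>p\<in>{p. p dvd l + r}. attractors_of_period p l r) \<subseteq> (\<Union>p\<in>{1..}. attractors_of_period p l r)"
      by blast
  qed
  \<comment> \<open>The period of an attractor is its cardinality, so none is counted for two
    different \<open>p\<close>.\<close>
  moreover have "card \<dots> = (\<Sum>p | p dvd l + r. num_attractors_of_period p l r)"
    unfolding num_attractors_of_period_def using assms
    by (intro card_UN_disjoint) (auto simp: finite_attractors_of_period dest!: card_attractor)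
  ultimately show ?thesis
    by (simp add: num_attractors_def)
qed

text \<open>Moebius inversion of the partition by exact period, with \<open>p\<close> configurations
  per attractor.\<close>

lemma num_attractors_of_period_formula:
  assumes "p \<ge> 1"
  shows "real p * real (num_attractors_of_period p l r)
    = (\<Sum>q | q dvd p. of_int (moebius_mu (p div q)) * real (num_period_configs q l r))"
proof -
  define e where "e q = real (card (exact_period_configs q l r))" for q
  have "(\<Sum>q | q dvd p. of_int (moebius_mu (p div q)) * real (num_period_configs q l r))
      = (\<Sum>q | q dvd p. of_int (moebius_mu (p div q)) * (\<Sum>d | d dvd q. e d))"
  proof (intro sum.cong refl arg_cong2[where f = "(*)"])
    fix q assume "q \<in> {q. q dvd p}"
    then have "q \<ge> 1"
      using assms by (cases "q = 0") auto
    then show "real (num_period_configs q l r) = (\<Sum>d | d dvd q. e d)"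
      by (simp add: e_def num_period_configs_eq_sum)
  qed
  also have "\<dots> = (\<Sum>d | d dvd p. e d * (\<Sum>k | k dvd p div d. of_int (moebius_mu k)))"
    using assms by (intro sum_divisors_convolution) simp
  \<comment> \<open>The sum of the Moebius function over the divisors of \<open>p div d\<close>
    vanishes unless \<open>d = p\<close>.\<close>
  also have "\<dots> = (\<Sum>d | d dvd p. if d = p then e d else 0)"
  proof (intro sum.cong refl)
    fix d assume "d \<in> {d. d dvd p}"
    then obtain k where k: "p = d * k" "d > 0" "k > 0"
      using assms by (auto elim!: dvdE)
    then show "e d * (\<Sum>k | k dvd p div d. of_int (moebius_mu k)) = (if d = p then e d else 0)"
      using sum_moebius_mu[of k] by (simp flip: of_int_sum)
  qed
  also have "\<dots> = e p"
    using assms by simp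
  also have "\<dots> = real p * real (num_attractors_of_period p l r)"
    by (simp add: e_def flip: period_mult_num_attractors_of_period)
  finally show ?thesis ..
qed

text \<open>The totients of the divisors of \<open>(l + r) div d\<close> add up to that number;
  times the \<open>d\<close> configurations of an attractor this is \<open>l + r\<close>, so every
  attractor gets the same weight.\<close>

lemma num_attractors_formula:
  assumes "l \<ge> 1" "r \<ge> 1"
  shows "(l + r) * num_attractors l r
    = (\<Sum>m | m dvd l + r. totient ((l + r) div m) * num_period_configs m l r)"
proof -
  have "(\<Sum>m | m dvd l + r. totient ((l + r) div m) * num_period_configs m l r)
      = (\<Sum>m | m dvd l + r. totient ((l + r) div m) * (\<Sum>d | d dvd m. card (exact_period_configs d l r)))"
  proof (intro sum.cong refl arg_cong2[where f = "(*)"])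
    fix m assume "m \<in> {m. m dvd l + r}"
    then have "m \<ge> 1"
      using assms by (cases "m = 0") auto
    then show "num_period_configs m l r = (\<Sum>d | d dvd m. card (exact_period_configs d l r))"
      by (rule num_period_configs_eq_sum)
  qed
  also have "\<dots> = (\<Sum>d | d dvd l + r. card (exact_period_configs d l r) * (\<Sum>k | k dvd (l + r) div d. totient k))"
    using assms by (intro sum_divisors_convolution) simp
  also have "\<dots> = (\<Sum>d | d dvd l + r. (l + r) * num_attractors_of_period d l r)"
    by (intro sum.cong refl)
      (auto simp: totient_divisor_sum mult_ac simp flip: period_mult_num_attractors_of_period)
  also have "\<dots> = (l + r) * num_attractors l r"
    by (simp add: num_attractors_eq_sum[OF assms] sum_distrib_left)
  finally show ?thesis ..
qed

lemma num_attractors_perrin: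
  assumes "l \<ge> 1" "r \<ge> 1"
  shows "real (num_attractors l r) = 1 / real (l + r) * (\<Sum>m | m dvd l + r.
    real (totient ((l + r) div m)) * real (perrin (m div gcd (gcd l r) m) ^ gcd (gcd l r) m))"
proof -
  have "real (l + r) * real (num_attractors l r) = (\<Sum>m | m dvd l + r.
      real (totient ((l + r) div m)) * real (perrin (m div gcd (gcd l r) m) ^ gcd (gcd l r) m))"
    using num_attractors_formula[OF assms, THEN arg_cong[where f = real]]
    by (simp add: num_period_configs_eq_perrin[OF assms] del: of_nat_add)
  then show ?thesis
    using assms by (simp add: field_simps del: of_nat_add)
qed

theorem proposition6:
  fixes l r N \<Delta> :: nat
  assumes "l \<ge> 1" and "r \<ge> 1"
    and "N = l + r" and "\<Delta> = gcd l r"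
  shows
    "(\<forall>p. p dvd N \<and> \<not> p dvd l \<and> \<not> p dvd r \<longrightarrow>
        num_period_configs p l r = perrin (p div gcd \<Delta> p) ^ gcd \<Delta> p
      \<and> (\<forall>l' r'. l' \<ge> 1 \<and> r' \<ge> 1 \<and> p dvd l' + r' \<and> \<not> p dvd l' \<and> \<not> p dvd r'
            \<and> gcd (gcd l' r') p = gcd \<Delta> p
            \<longrightarrow> num_period_configs p l' r' = num_period_configs p l r)
      \<and> real (num_attractors_of_period p l r) =
          1 / real p * (\<Sum>q | q dvd p.
            of_int (moebius_mu (p div q)) * real (perrin (q div gcd \<Delta> q) ^ gcd \<Delta> q)))
     \<and> real (num_attractors l r) =
          1 / real N * (\<Sum>m | m dvd N.
            real (totient (N div m)) * real (perrin (m div gcd \<Delta> m) ^ gcd \<Delta> m))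
     \<and> (\<forall>l' r'. l' \<ge> 1 \<and> r' \<ge> 1 \<and> l' + r' = N \<and> gcd l' r' = \<Delta>
            \<longrightarrow> num_attractors l' r' = num_attractors l r)"
proof (intro conjI allI impI; (elim conjE)?)
  fix p assume p: "p dvd N"
  show C: "num_period_configs p l r = perrin (p div gcd \<Delta> p) ^ gcd \<Delta> p"
    using num_period_configs_eq_perrin p assms by simp
  show "num_period_configs p l' r' = num_period_configs p l r"
    if "l' \<ge> 1" "r' \<ge> 1" "p dvd l' + r'" "gcd (gcd l' r') p = gcd \<Delta> p" for l' r'
    using num_period_configs_eq_perrin[OF that(1-3)] C that(4) by simp
  have "p \<ge> 1"
    using p assms by (cases "p = 0") auto
  have "real p * real (num_attractors_of_period p l r) = (\<Sum>q | q dvd p.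
      of_int (moebius_mu (p div q)) * real (perrin (q div gcd \<Delta> q) ^ gcd \<Delta> q))"
    unfolding num_attractors_of_period_formula[OF \<open>p \<ge> 1\<close>]
  proof (intro sum.cong refl)
    fix q assume "q \<in> {q. q dvd p}"
    then have "q dvd l + r"
      using p assms(3) by (auto intro: dvd_trans)
    then show "of_int (moebius_mu (p div q)) * real (num_period_configs q l r)
        = of_int (moebius_mu (p div q)) * real (perrin (q div gcd \<Delta> q) ^ gcd \<Delta> q)"
      using num_period_configs_eq_perrin assms by simp
  qed
  then show "real (num_attractors_of_period p l r) = 1 / real p * (\<Sum>q | q dvd p.
      of_int (moebius_mu (p div q)) * real (perrin (q div gcd \<Delta> q) ^ gcd \<Delta> q))"
    using \<open>p \<ge> 1\<close> by (simp add: field_simps)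
next
  show "real (num_attractors l r) = 1 / real N * (\<Sum>m | m dvd N.
      real (totient (N div m)) * real (perrin (m div gcd \<Delta> m) ^ gcd \<Delta> m))"
    using num_attractors_perrin assms by simp
next
  fix l' r' assume "l' \<ge> 1" "r' \<ge> 1" "l' + r' = N" "gcd l' r' = \<Delta>"
  \<comment> \<open>The formula involves \<open>l'\<close> and \<open>r'\<close> only through their
    sum and gcd.\<close>
  then have "real (num_attractors l' r') = real (num_attractors l r)"
    using num_attractors_perrin assms by simp
  then show "num_attractors l' r' = num_attractors l r"
    by simp
qed

end
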